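(* Let $\lambda,\alpha>0$. Let $U$ be an exponentially distributed random variable with parameter $\lambda$, and let $B^{el}_\alpha(t)$, $t>0$, be the elastic Brownian motion with absorbing rate $\alpha$, independent of $U$, whose one-dimensional law is $q^{el}_\alpha(s,t)$. Let $\psi^{el}_\alpha(t)=\Pr\{B^{el}_\alpha(t)<U\}$ be the crossing probability of $U$ by $B^{el}_\alpha(t)$. Then, for $\lambda\ne\alpha$, $$\psi^{el}_\alpha(t)=1-\frac{\lambda}{\lambda-\alpha}\left[E_{\frac12,1}\left(-\frac{\alpha\sqrt t}{\sqrt2}\right)-E_{\frac12,1}\left(-\frac{\lambda\sqrt t}{\sqrt2}\right)\right],$$ while for $\alpha=\lambda$ $$\psi^{el}_\lambda(t)=1-\lambda\sqrt{2t}\,E_{\frac12,\frac12}\left(-\frac{\lambda\sqrt t}{\sqrt2}\right).$$ Moreover, for any $\alpha,\lambda>0$, $\psi^{el}_\alpha$ satisfies the fractional differential equation $$\frac{d}{dt}\psi^{el}_\alpha+\frac{\alpha+\lambda}{\sqrt2}\frac{d^{1/2}}{dt^{1/2}}\psi^{el}_\alpha=\frac{\alpha\lambda}{2}\left(1-\psi^{el}_\alpha\right)-\frac{\lambda}{\sqrt{2\pi t}},\quad t>0,\qquad \psi^{el}_\alpha(0)=1.$$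
   Context: The elastic Brownian motion with absorbing rate $\alpha>0$ is $B^{el}_\alpha(t)=|B(t)|$ for $t<T_\alpha$ and $B^{el}_\alpha(t)=0$ for $t\ge T_\alpha$, where $B$ is a standard Brownian motion from $0$ ($\operatorname{Var}B(t)=t$) and $T_\alpha$ is a random time with $\Pr\{T_\alpha>t\mid\mathcal{B}_t\}=e^{-\alpha L(0,t)}$, $\mathcal{B}_t=\sigma\{B(s),s\le t\}$, $L(0,t)=\lim_{\varepsilon\downarrow0}\frac{1}{2\varepsilon}\mathrm{meas}\{s\le t:|B(s)|<\varepsilon\}$. Its one-dimensional law is (a well-known fact, which may be taken as the definition of the law) $$q^{el}_\alpha(s,t)=2e^{\alpha s}\int_s^{+\infty}we^{-\alpha w}\frac{e^{-\frac{w^2}{2t}}}{\sqrt{2\pi t^3}}\,dw+q_\alpha(t)\,\delta(s),\quad s\ge0,\ t>0,$$ where $\delta$ is the Dirac mass at $0$ and $$q_\alpha(t)=1-2e^{\frac{\alpha^2t}{2}}\int_{\alpha\sqrt t}^{+\infty}\frac{e^{-w^2/2}}{\sqrt{2\pi}}\,dw.$$ Thus $\psi^{el}_\alpha(t)=\int_{[0,\infty)}e^{-\lambda s}q^{el}_\alpha(s,t)\,ds$, the atom at $0$ contributing its full mass $q_\alpha(t)$. $E_{\alpha,\beta}(z)=\sum_{r=0}^\infty\frac{z^r}{\Gamma(\alpha r+\beta)}$ is the Mittag-Leffler function. $\frac{d^{1/2}}{dt^{1/2}}u(t)=\frac{1}{\Gamma(1/2)}\int_0^t(t-s)^{-1/2}u'(s)\,ds$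 is the Caputo derivative. "Exponential with parameter $\lambda$" means density $\lambda e^{-\lambda y}$, $y>0$. The value at $t=0$ is understood as the limit $t\to0^+$. *)

theory Defs
  imports "HOL-Probability.Probability"
begin

definition mittag_leffler :: "real \<Rightarrow> real \<Rightarrow> real \<Rightarrow> real" where
  "mittag_leffler a b z = (\<Sum>r. z ^ r / Gamma (a * real r + b))"

(* The integrand of the Caputo derivative of order 1/2; it involves u only on the open
   interval (0,t), so neither u nor its derivative need be meaningful at 0. *)
definition caputo_half_integrand :: "(real \<Rightarrow> real) \<Rightarrow> real \<Rightarrow> real \<Rightarrow> real" where
  "caputo_half_integrand u t s = (t - s) powr (-1/2) * deriv u s"

definition caputo_half :: "(real \<Rightarrow> real) \<Rightarrow> real \<Rightarrow> real" where
  "caputo_half u t = 1 / Gamma (1/2) * (LBINT s:{0<..<t}. caputo_half_integrand u t s)"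

definition elastic_density :: "real \<Rightarrow> real \<Rightarrow> real \<Rightarrow> real" where
  "elastic_density \<alpha> t s =
     2 * exp (\<alpha> * s) *
       (LBINT w:{s<..}. w * exp (- \<alpha> * w) * (exp (- (w\<^sup>2) / (2 * t)) / sqrt (2 * pi * t ^ 3)))"

definition elastic_atom :: "real \<Rightarrow> real \<Rightarrow> real" where
  "elastic_atom \<alpha> t =
     1 - 2 * exp (\<alpha>\<^sup>2 * t / 2) * (LBINT w:{\<alpha> * sqrt t<..}. exp (- (w\<^sup>2) / 2) / sqrt (2 * pi))"

(* The one-dimensional law at time t of the elastic Brownian motion with absorbing rate \<alpha>:
   the density above on [0,\<infinity>) plus a Dirac mass at 0. *)
definition has_elastic_law :: "'a measure \<Rightarrow> real \<Rightarrow> real \<Rightarrow> ('a \<Rightarrow> real) \<Rightarrow> bool" where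
  "has_elastic_law M \<alpha> t Y \<longleftrightarrow>
     Y \<in> borel_measurable M \<and>
     (\<forall>A\<in>sets borel. emeasure (distr M borel Y) A =
        (\<integral>\<^sup>+ s \<in> A \<inter> {0..}. ennreal (elastic_density \<alpha> t s) \<partial>lborel)
        + ennreal (elastic_atom \<alpha> t) * indicator A 0)"

definition crossing_prob ::
    "'a measure \<Rightarrow> (real \<Rightarrow> 'a \<Rightarrow> real) \<Rightarrow> ('a \<Rightarrow> real) \<Rightarrow> real \<Rightarrow> real" where
  "crossing_prob M B U t = measure M {\<omega> \<in> space M. B t \<omega> < U \<omega>}"

end

(* The survival function of the elastic Brownian motion is explicit:
   T(u) = Pr{B(t) >= u} = exp(-u^2/(2t)) erfcx((u + alpha t)/sqrt(2t)) for u > 0, where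
   erfcx x = E_{1/2,1}(-x) = exp(x^2) erfc x.  It solves T' = alpha T - 2 phi_t with phi_t the
   centred Gaussian density of variance t, so the density of the law is -T', and
   1 - psi = lam int_0^oo exp(-lam u) T(u) du has an elementary antiderivative built from T, its
   analogue with rate lam, and phi_t.

   Either Mittag-Leffler formula expands psi as 1 + sum_r b_r t^(r/2) / Gamma(r/2 + 1).  On such
   series the Caputo derivative of order 1/2 shifts the coefficients by one (a Beta integral for
   each term), and d/dt shifts them by two and leaves the term b_1 / sqrt(pi t).  The fractional
   equation is thus the recursion b_{r+2} + (a + l) b_{r+1} + a l b_r = 0 with a = alpha/sqrt 2,
   l = lam/sqrt 2, together with b_1 = -l. *)
theory Submission
  imports Defs "HOL-Real_Asymp.Real_Asymp"
begin

subsection \<open>Power series with Mittag-Leffler denominators\<close>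

text \<open>Taken in the variable x = sqrt t: half-integer powers of t become an ordinary power
  series, open to termwise differentiation.\<close>

definition ml_series :: "(nat \<Rightarrow> real) \<Rightarrow> real \<Rightarrow> real" where
  "ml_series b x = (\<Sum>r. b r * x ^ r / Gamma (real r / 2 + 1))"

text \<open>Survives shifts and sums, and is still strong enough for the Gamma denominators to give
  convergence at every x.\<close>

definition geometric_growth :: "(nat \<Rightarrow> real) \<Rightarrow> bool" where
  "geometric_growth b \<longleftrightarrow> (\<exists>C K. C \<ge> 0 \<and> K \<ge> 0 \<and> (\<forall>r. \<bar>b r\<bar> \<le> C * K ^ r))"

lemma Gamma_half_shift_pos: "Gamma (real r / 2 + 1) > 0"
  by (rule Gamma_real_pos) (simp add: add_nonneg_pos)

lemma Gamma_half_shift_Suc: "Gamma (real (Suc r) / 2 + 1) = real (Suc r) / 2 * Gamma ((real r + 1) / 2)"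
proof -
  have "(real r + 1) / 2 > 0" by simp
  then have "(real r + 1) / 2 \<notin> \<int>\<^sub>\<le>\<^sub>0" by (auto elim!: nonpos_Ints_cases)
  from Gamma_plus1[OF this] show ?thesis by (simp add: add.commute)
qed

text \<open>Induction in steps of two: Gamma(x + 1) = x Gamma(x) raises r by two with the factor r/2
  + 1, while the factorial gains only r div 2 + 1. The numerator 2 leaves room for r = 1, where the
  left side is 2 / sqrt pi.\<close>

lemma inverse_Gamma_half_shift_le: "1 / Gamma (real r / 2 + 1) \<le> 2 / fact (r div 2)"
proof (induction r rule: induct_nat_012)
  case 0
  show ?case by simp
next
  case 1
  have "sqrt pi \<ge> 1" using pi_ge_two by (intro real_le_rsqrt) simp
  then have "1 \<le> Gamma (real (Suc 0) / 2 + 1) * 2"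
    using Gamma_half_shift_Suc[of 0] Gamma_one_half_real by simp
  then show ?case using Gamma_half_shift_pos[of "Suc 0"] by (simp add: divide_simps mult_ac)
next
  case (ge2 n)
  let ?x = "real n / 2 + 1"
  have "Gamma (real (Suc (Suc n)) / 2 + 1) = ?x * Gamma ?x"
    using Gamma_half_shift_Suc[of "Suc n"] by (simp add: add_divide_distrib algebra_simps)
  then have "1 / Gamma (real (Suc (Suc n)) / 2 + 1) = 1 / ?x * (1 / Gamma ?x)" by simp
  also have "\<dots> \<le> 1 / real (Suc (n div 2)) * (2 / fact (n div 2))"
  proof (rule mult_mono)
    have "real (n div 2) \<le> real n / 2" by linarith
    then show "1 / ?x \<le> 1 / real (Suc (n div 2))" by (intro divide_left_mono) (auto intro!: mult_pos_pos add_nonneg_pos)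
  qed (use ge2 Gamma_half_shift_pos[of n] in auto)
  also have "\<dots> = 2 / fact (Suc (Suc n) div 2)" by (simp add: field_simps)
  finally show ?case .
qed

text \<open>Split by parity: the even terms sum to exp(x^2), the odd ones to x exp(x^2).\<close>

lemma summable_power_over_fact_half: "summable (\<lambda>r. x ^ r / fact (r div 2))" for x :: real
proof -
  have e: "(\<lambda>k. (x\<^sup>2) ^ k / fact k) sums exp (x\<^sup>2)"
    using exp_converges[of "x\<^sup>2"] by (simp add: divide_inverse mult.commute)
  have o: "(\<lambda>k. x * ((x\<^sup>2) ^ k / fact k)) sums (x * exp (x\<^sup>2))"
    by (rule sums_mult[OF e])
  have "(\<lambda>r. x ^ r / fact (r div 2)) =
    (\<lambda>r. if even r then (x\<^sup>2) ^ (r div 2) / fact (r div 2) else x * ((x\<^sup>2) ^ ((r - 1) div 2) / fact ((r - 1) div 2)))"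
  proof
    fix r
    show "x ^ r / fact (r div 2) = (if even r then (x\<^sup>2) ^ (r div 2) / fact (r div 2) else x * ((x\<^sup>2) ^ ((r - 1) div 2) / fact ((r - 1) div 2)))"
      by (cases "even r") (auto elim!: evenE oddE simp: power_mult)
  qed
  then show ?thesis using sums_if[OF o e] by (simp add: sums_iff)
qed

lemma ml_series_abs_summable:
  assumes "geometric_growth b"
  shows "summable (\<lambda>r. \<bar>b r * x ^ r / Gamma (real r / 2 + 1)\<bar>)"
proof -
  obtain C K where C: "C \<ge> 0" "K \<ge> 0" "\<And>r. \<bar>b r\<bar> \<le> C * K ^ r"
    using assms by (auto simp: geometric_growth_def)
  have "\<bar>b r * x ^ r / Gamma (real r / 2 + 1)\<bar> \<le> 2 * C * ((K * \<bar>x\<bar>) ^ r / fact (r div 2))" for r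
  proof -
    have "\<bar>b r * x ^ r / Gamma (real r / 2 + 1)\<bar> = (\<bar>b r\<bar> * \<bar>x\<bar> ^ r) * (1 / Gamma (real r / 2 + 1))"
      using Gamma_half_shift_pos[of r] by (simp add: abs_mult power_abs)
    also have "\<dots> \<le> (C * K ^ r * \<bar>x\<bar> ^ r) * (2 / fact (r div 2))"
      using C inverse_Gamma_half_shift_le[of r] Gamma_half_shift_pos[of r]
      by (intro mult_mono) (auto intro!: mult_nonneg_nonneg)
    finally show ?thesis by (simp add: power_mult_distrib mult_ac)
  qed
  then show ?thesis
    by (intro summable_comparison_test'[OF summable_mult[OF summable_power_over_fact_half], where N = 0]) auto
qed

lemma ml_series_summable:
  "geometric_growth b \<Longrightarrow> summable (\<lambda>r. b r * x ^ r / Gamma (real r / 2 + 1))"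
  using ml_series_abs_summable by (rule summable_rabs_cancel)

lemma ml_series_0: "ml_series b 0 = b 0"
  by (simp add: ml_series_def powser_zero[of "\<lambda>r. b r / Gamma (real r / 2 + 1)", simplified])

section \<open>Closure properties of geometric growth and linearity of the series\<close>

lemma geometric_growth_Suc:
  assumes "geometric_growth b"
  shows "geometric_growth (\<lambda>r. b (Suc r))"
proof -
  obtain C K where C: "C \<ge> 0" "K \<ge> 0" "\<And>r. \<bar>b r\<bar> \<le> C * K ^ r"
    using assms by (auto simp: geometric_growth_def)
  then have "\<bar>b (Suc r)\<bar> \<le> (C * K) * K ^ r" for r
    using C(3)[of "Suc r"] by (simp add: mult_ac)
  with C show ?thesis unfolding geometric_growth_def by (intro exI[of _ "C * K"] exI[of _ K]) auto
qed

lemma geometric_growth_power: "geometric_growth (\<lambda>r. c ^ r)"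
  unfolding geometric_growth_def
  by (intro exI[of _ 1] exI[of _ "\<bar>c\<bar>"]) (auto simp: power_abs)

text \<open>The factor r is absorbed by r < 2^r. Such coefficients belong to a double characteristic
  root, the case of equal rates.\<close>

lemma geometric_growth_mult_power: "geometric_growth (\<lambda>r. real r * c ^ r)"
proof -
  have "\<bar>real r * c ^ r\<bar> \<le> 1 * (2 * \<bar>c\<bar>) ^ r" for r
    using of_nat_less_two_power[of r, where ?'a = real]
    by (auto simp: abs_mult power_abs power_mult_distrib less_imp_le intro!: mult_right_mono)
  then show ?thesis unfolding geometric_growth_def by (intro exI[of _ 1] exI[of _ "2 * \<bar>c\<bar>"]) auto
qed

lemma geometric_growth_cmult:
  assumes "geometric_growth b" shows "geometric_growth (\<lambda>r. c * b r)"
proof -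
  obtain C K where C: "C \<ge> 0" "K \<ge> 0" "\<And>r. \<bar>b r\<bar> \<le> C * K ^ r"
    using assms by (auto simp: geometric_growth_def)
  then have "\<bar>c * b r\<bar> \<le> (\<bar>c\<bar> * C) * K ^ r" for r
    by (auto simp: abs_mult mult.assoc intro: mult_left_mono)
  with C show ?thesis unfolding geometric_growth_def by (intro exI[of _ "\<bar>c\<bar> * C"] exI[of _ K]) auto
qed

lemma geometric_growth_add:
  assumes "geometric_growth b" "geometric_growth b'" shows "geometric_growth (\<lambda>r. b r + b' r)"
proof -
  obtain C K where C: "C \<ge> 0" "K \<ge> 0" "\<And>r. \<bar>b r\<bar> \<le> C * K ^ r"
    using assms by (auto simp: geometric_growth_def)
  obtain C' K' where C': "C' \<ge> 0" "K' \<ge> 0" "\<And>r. \<bar>b' r\<bar> \<le> C' * K' ^ r"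
    using assms by (auto simp: geometric_growth_def)
  have "\<bar>b r + b' r\<bar> \<le> (C + C') * (max K K') ^ r" for r
  proof -
    have "\<bar>b r + b' r\<bar> \<le> C * K ^ r + C' * K' ^ r" using C(3)[of r] C'(3)[of r] by linarith
    also have "\<dots> \<le> C * (max K K') ^ r + C' * (max K K') ^ r"
      using C C' by (intro add_mono mult_left_mono power_mono) auto
    finally show ?thesis by (simp add: algebra_simps)
  qed
  with C C' show ?thesis unfolding geometric_growth_def
    by (intro exI[of _ "C + C'"] exI[of _ "max K K'"]) (auto simp: le_max_iff_disj)
qed

lemma ml_series_cmult: "geometric_growth b \<Longrightarrow> ml_series (\<lambda>r. c * b r) x = c * ml_series b x"
  unfolding ml_series_def using suminf_mult[OF ml_series_summable] by (simp add: mult_ac)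

lemma ml_series_add:
  "geometric_growth b \<Longrightarrow> geometric_growth b' \<Longrightarrow> ml_series (\<lambda>r. b r + b' r) x = ml_series b x + ml_series b' x"
  unfolding ml_series_def using suminf_add[OF ml_series_summable ml_series_summable, of b b' x x]
  by (simp add: algebra_simps add_divide_distrib)

text \<open>Gamma(x + 1) = x Gamma(x) at x = (r + 1)/2 cancels the factor r + 1 produced by
  differentiation and leaves a 2.\<close>

lemma diffs_ml_coeffs:
  "diffs (\<lambda>r. b r / Gamma (real r / 2 + 1)) r * x ^ r = 2 * (b (Suc r) * x ^ r / Gamma ((real r + 1) / 2))"
proof -
  have "Gamma ((real r + 1) / 2) > 0" by (rule Gamma_real_pos) simp
  then show ?thesis
    unfolding diffs_def Gamma_half_shift_Suc by (simp add: divide_simps del: of_nat_Suc)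
qed

lemma has_field_derivative_ml_series:
  assumes "geometric_growth b"
  shows "(ml_series b has_real_derivative (\<Sum>r. 2 * b (Suc r) * x ^ r / Gamma ((real r + 1) / 2))) (at x)"
proof -
  let ?c = "\<lambda>r. b r / Gamma (real r / 2 + 1)"
  have "((\<lambda>x. \<Sum>r. ?c r * x ^ r) has_real_derivative (\<Sum>r. diffs ?c r * x ^ r)) (at x)"
    by (rule termdiffs_strong_converges_everywhere) (use ml_series_summable[OF assms] in simp)
  moreover have "diffs ?c r * x ^ r = 2 * b (Suc r) * x ^ r / Gamma ((real r + 1) / 2)" for r
    using diffs_ml_coeffs[of b r x] by simp
  ultimately show ?thesis by (simp add: ml_series_def[abs_def])
qed

lemma ml_series_deriv_summable:
  assumes "geometric_growth b"
  shows "summable (\<lambda>r. b (Suc r) * x ^ r / Gamma ((real r + 1) / 2))"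
proof -
  have "summable (\<lambda>r. diffs (\<lambda>r. b r / Gamma (real r / 2 + 1)) r * x ^ r)"
    by (rule termdiff_converges_all) (use ml_series_summable[OF assms] in simp)
  moreover have "diffs (\<lambda>r. b r / Gamma (real r / 2 + 1)) r * x ^ r = 2 * (b (Suc r) * x ^ r / Gamma ((real r + 1) / 2))" for r
    by (rule diffs_ml_coeffs)
  ultimately have "summable (\<lambda>r. 2 * (b (Suc r) * x ^ r / Gamma ((real r + 1) / 2)))" by simp
  then show ?thesis by (subst (asm) summable_cmult_iff) simp
qed

text \<open>The head has denominator Gamma(1/2) = sqrt pi; after an index shift the rest has
  denominators Gamma(r/2 + 1) again. The head is the origin of the singular term in 1 / sqrt
  t.\<close>

lemma ml_series_deriv_split:
  assumes "geometric_growth b"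
  shows "(\<Sum>r. b (Suc r) * x ^ r / Gamma ((real r + 1) / 2)) = b 1 / sqrt pi + x * ml_series (\<lambda>r. b (Suc (Suc r))) x"
proof -
  have "(\<Sum>r. b (Suc r) * x ^ r / Gamma ((real r + 1) / 2)) =
     b 1 / sqrt pi + (\<Sum>r. b (Suc (Suc r)) * x ^ Suc r / Gamma ((real (Suc r) + 1) / 2))"
    using suminf_split_head[OF ml_series_deriv_summable[OF assms], of x] Gamma_one_half_real by simp
  also have "(\<Sum>r. b (Suc (Suc r)) * x ^ Suc r / Gamma ((real (Suc r) + 1) / 2)) =
     (\<Sum>r. x * (b (Suc (Suc r)) * x ^ r / Gamma (real r / 2 + 1)))"
    by (intro suminf_cong) (simp add: add_divide_distrib mult_ac add.commute)
  also have "\<dots> = x * ml_series (\<lambda>r. b (Suc (Suc r))) x"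
    unfolding ml_series_def
    by (intro suminf_mult ml_series_summable geometric_growth_Suc assms)
  finally show ?thesis .
qed

lemma isCont_ml_series: "geometric_growth b \<Longrightarrow> isCont (ml_series b) x"
  using has_field_derivative_ml_series DERIV_isCont by blast

section \<open>The functions E_{1/2,1} and E_{1/2,1/2}\<close>

lemma mittag_leffler_half_one: "mittag_leffler (1/2) 1 (c * x) = ml_series (\<lambda>r. c ^ r) x"
  by (simp add: mittag_leffler_def ml_series_def power_mult_distrib)

lemma mittag_leffler_half_one': "mittag_leffler (1/2) 1 = ml_series (\<lambda>_. 1)"
  by (simp add: mittag_leffler_def ml_series_def fun_eq_iff)

lemma geometric_growth_1: "geometric_growth (\<lambda>_. 1)"
  using geometric_growth_power[of 1] by simp

text \<open>All coefficients are 1, so the shift by two reproduces the function: it solves the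
  linear equation of exp(z^2) erfc(-z).\<close>

lemma DERIV_mittag_leffler_half:
  "(mittag_leffler (1/2) 1 has_real_derivative 2 * z * mittag_leffler (1/2) 1 z + 2 / sqrt pi) (at z)"
proof -
  have "(\<Sum>r. 2 * 1 * z ^ r / Gamma ((real r + 1) / 2)) = 2 * (\<Sum>r. 1 * z ^ r / Gamma ((real r + 1) / 2))"
    using suminf_mult[OF ml_series_deriv_summable[OF geometric_growth_1], of 2 z] by simp
  then show ?thesis
    using has_field_derivative_ml_series[OF geometric_growth_1, of z]
      ml_series_deriv_split[OF geometric_growth_1, of z]
    by (simp add: mittag_leffler_half_one' algebra_simps)
qed

lemma mittag_leffler_half_half:
  "mittag_leffler (1/2) (1/2) z = 1 / sqrt pi + z * mittag_leffler (1/2) 1 z"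
  using ml_series_deriv_split[OF geometric_growth_1, of z]
  by (simp add: mittag_leffler_half_one' mittag_leffler_def[of _ "1/2"] add_divide_distrib)

text \<open>The term r = 0 vanishes, and in the others r cancels against the r/2 released by
  Gamma(r/2 + 1). This turns the closed form for equal rates into an
  \<open>ml_series\<close>.\<close>

lemma mittag_leffler_half_half_ml_series:
  "2 * (c * x) * mittag_leffler (1/2) (1/2) (c * x) = ml_series (\<lambda>r. real r * c ^ r) x"
proof -
  have "ml_series (\<lambda>r. real r * c ^ r) x = (\<Sum>r. real (Suc r) * c ^ Suc r * x ^ Suc r / Gamma (real (Suc r) / 2 + 1))"
    unfolding ml_series_def using suminf_split_head[OF ml_series_summable[OF geometric_growth_mult_power], of c x] by simp
  also have "\<dots> = (\<Sum>r. 2 * (c * x) * (1 * (c * x) ^ r / Gamma ((real r + 1) / 2)))"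
  proof (intro suminf_cong)
    fix r
    have "Gamma ((real r + 1) / 2) > 0" by (rule Gamma_real_pos) simp
    then show "real (Suc r) * c ^ Suc r * x ^ Suc r / Gamma (real (Suc r) / 2 + 1) = 2 * (c * x) * (1 * (c * x) ^ r / Gamma ((real r + 1) / 2))"
      unfolding Gamma_half_shift_Suc by (simp add: divide_simps power_mult_distrib del: of_nat_Suc)
  qed
  also have "\<dots> = 2 * (c * x) * (\<Sum>r. 1 * (c * x) ^ r / Gamma ((real r + 1) / 2))"
    by (rule suminf_mult[OF ml_series_deriv_summable[OF geometric_growth_1]])
  finally show ?thesis by (simp add: mittag_leffler_def add_divide_distrib)
qed

subsection \<open>The Caputo derivative of order one half\<close>

text \<open>Substitution s = t u in the Beta integral: the exponents -1/2 and p - 1 give t^(p -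
  3/2), and the Jacobian raises this to t^(p - 1/2).\<close>

lemma Beta_half_scaled:
  assumes "t > 0" "p > (0::real)"
  shows "set_integrable lborel {0<..<t} (\<lambda>s. (t - s) powr (-1/2) * s powr (p - 1))"
    and "(LBINT s:{0<..<t}. (t - s) powr (-1/2) * s powr (p - 1)) = Beta p (1/2) * t powr (p - 1/2)"
proof -
  define f where "f s = indicator {0<..<t} s *\<^sub>R ((t - s) powr (-1/2) * s powr (p - 1))" for s
  define g where "g u = indicator {0..1} u *\<^sub>R (u powr (p - 1) * (1 - u) powr (1/2 - 1))" for u :: real
  have g: "integrable lborel g"
    using integrable_Beta[of p "1/2"] assms unfolding set_integrable_def g_def by simp
  have "integral\<^sup>L lborel g = integral {0..1} (\<lambda>u. u powr (p - 1) * (1 - u) powr (1/2 - 1))"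
    using set_borel_integral_eq_integral(2)[OF integrable_Beta[of p "1/2"]] assms
    unfolding set_lebesgue_integral_def g_def by simp
  also have "\<dots> = Beta p (1/2)"
    using has_integral_Beta_real[of p "1/2"] assms by (intro integral_unique) simp
  finally have gi: "integral\<^sup>L lborel g = Beta p (1/2)" .
  \<comment> \<open>\<open>g\<close> lives on a closed interval and \<open>f\<close> on an open one;
    the endpoints are left out here and discarded as a null set below.\<close>
  have fg: "f (0 + t * u) = t powr (p - 3/2) * g u" if "u \<noteq> 0" "u \<noteq> 1" for u
  proof (cases "0 < u \<and> u < 1")
    case True
    have "t - t * u = t * (1 - u)" by (simp add: algebra_simps)
    then have "(t - t * u) powr (-1/2) * (t * u) powr (p - 1) =
        (t powr (-1/2) * t powr (p - 1)) * (u powr (p - 1) * (1 - u) powr (-1/2))"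
      using True assms by (simp add: powr_mult)
    also have "t powr (-1/2) * t powr (p - 1) = t powr (p - 3/2)"
      by (simp add: powr_add[symmetric])
    finally show ?thesis using True assms by (simp add: f_def g_def)
  next
    case False
    then show ?thesis using that assms by (auto simp: f_def g_def indicator_def zero_less_mult_iff)
  qed
  have AE: "AE u in lborel. f (0 + t * u) = t powr (p - 3/2) * g u"
    using AE_lborel_singleton[of 0] AE_lborel_singleton[of 1] by eventually_elim (rule fg)
  have [measurable]: "f \<in> borel_measurable borel" unfolding f_def by measurable
  have "integrable lborel (\<lambda>u. f (0 + t * u)) \<longleftrightarrow> integrable lborel (\<lambda>u. t powr (p - 3/2) * g u)"
    using AE g by (intro integrable_cong_AE) auto
  then have "integrable lborel (\<lambda>u. f (0 + t * u))" using g by simp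
  then show "set_integrable lborel {0<..<t} (\<lambda>s. (t - s) powr (-1/2) * s powr (p - 1))"
    using lborel_integrable_real_affine_iff[of t f 0] assms unfolding set_integrable_def f_def by simp
  have "integral\<^sup>L lborel f = t * (\<integral>u. f (0 + t * u) \<partial>lborel)"
    using lborel_integral_real_affine[of t f 0] assms by simp
  also have "(\<integral>u. f (0 + t * u) \<partial>lborel) = (\<integral>u. t powr (p - 3/2) * g u \<partial>lborel)"
    using AE g by (intro integral_cong_AE) auto
  also have "\<dots> = t powr (p - 3/2) * Beta p (1/2)" by (simp add: gi)
  also have "t * (t powr (p - 3/2) * Beta p (1/2)) = Beta p (1/2) * t powr (p - 1/2)"
    using assms powr_mult_base[of t "p - 3/2"] by (simp add: mult_ac)
  finally show "(LBINT s:{0<..<t}. (t - s) powr (-1/2) * s powr (p - 1)) = Beta p (1/2) * t powr (p - 1/2)"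
    unfolding set_lebesgue_integral_def f_def .
qed

text \<open>Brings the r-th term of the derivative into the shape s^(p - 1) with p = (r + 1)/2 that
  the Beta integral expects.\<close>

lemma sqrt_power_powr: "s > 0 \<Longrightarrow> sqrt s ^ r / sqrt s = s powr ((real r + 1) / 2 - 1)"
proof -
  assume s: "s > 0"
  have "(real r + 1) / 2 - 1 = real r * (1/2) - 1/2" by (simp add: field_simps)
  then have "s powr ((real r + 1) / 2 - 1) = (s powr (1/2)) powr real r / s powr (1/2)"
    by (simp only: powr_diff powr_powr mult.commute)
  then show ?thesis using s by (simp add: powr_half_sqrt powr_realpow)
qed

lemma sqrt_power_powr': "s > 0 \<Longrightarrow> s powr ((real r + 1) / 2 - 1/2) = sqrt s ^ r"
  using sqrt_power_powr[of s r] by (simp add: powr_half_sqrt[symmetric] powr_add[symmetric] field_simps)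

text \<open>The chain rule factor 1 / (2 sqrt t) cancels the 2 of the power series derivative. The
  unsplit form is the one to integrate term by term; the split form shows the shift by two.\<close>

lemma has_derivative_ml_series_sqrt:
  assumes "geometric_growth b" "t > 0"
  shows "((\<lambda>t. ml_series b (sqrt t)) has_real_derivative
    (\<Sum>r. b (Suc r) * (sqrt t ^ r / sqrt t) / Gamma ((real r + 1) / 2))) (at t)" (is ?A)
    and "(\<Sum>r. b (Suc r) * (sqrt t ^ r / sqrt t) / Gamma ((real r + 1) / 2))
      = b 1 / sqrt (pi * t) + ml_series (\<lambda>r. b (Suc (Suc r))) (sqrt t)" (is ?B)
proof -
  let ?S = "\<lambda>r. b (Suc r) * sqrt t ^ r / Gamma ((real r + 1) / 2)"
  have sm: "summable ?S" by (rule ml_series_deriv_summable[OF assms(1)])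
  have 1: "(\<Sum>r. 2 * b (Suc r) * sqrt t ^ r / Gamma ((real r + 1) / 2)) = 2 * suminf ?S"
    using suminf_mult[OF sm, of 2] by (simp add: mult_ac)
  have 2: "(\<Sum>r. b (Suc r) * (sqrt t ^ r / sqrt t) / Gamma ((real r + 1) / 2)) = suminf ?S / sqrt t"
    using suminf_divide[OF sm, of "sqrt t"] by (simp add: mult_ac)
  have "(sqrt has_real_derivative inverse (sqrt t) / 2) (at t)"
    using assms(2) by (rule DERIV_real_sqrt)
  from DERIV_chain2[OF has_field_derivative_ml_series[OF assms(1)] this]
  show ?A unfolding 1 2 by (simp add: field_simps)
  show ?B unfolding 2 ml_series_deriv_split[OF assms(1)] using assms by (simp add: field_simps real_sqrt_mult)
qed

text \<open>Since Beta(p, 1/2) = Gamma(p) sqrt pi / Gamma(p + 1/2) with p = (r + 1)/2, integrating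
  the r-th term of the derivative replaces Gamma((r + 1)/2) by Gamma(r/2 + 1); the sqrt pi cancels
  the prefactor of the Caputo derivative.\<close>

lemma caputo_half_ml_series:
  assumes b: "geometric_growth b" and t: "t > 0"
    and deriv: "\<And>s. 0 < s \<Longrightarrow> s < t \<Longrightarrow> (u has_real_derivative
      (\<Sum>r. b (Suc r) * (sqrt s ^ r / sqrt s) / Gamma ((real r + 1) / 2))) (at s)"
  shows "set_integrable lborel {0<..<t} (caputo_half_integrand u t)"
    and "caputo_half u t = ml_series (\<lambda>r. b (Suc r)) (sqrt t)"
proof -
  let ?p = "\<lambda>r. (real r + 1) / 2"
  let ?c = "\<lambda>r. b (Suc r) / Gamma (?p r)"
  let ?h = "\<lambda>r s. indicator {0<..<t} s *\<^sub>R ((t - s) powr (-1/2) * s powr (?p r - 1))"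
  let ?f = "\<lambda>r s. ?c r * ?h r s"
  have p: "?p r > 0" for r by simp
  have Gp: "Gamma (?p r) > 0" for r by (rule Gamma_real_pos) simp
  have h: "integrable lborel (?h r)" for r
    using Beta_half_scaled(1)[OF t p[of r]] unfolding set_integrable_def .
  have int_h: "integral\<^sup>L lborel (?h r) = Beta (?p r) (1/2) * sqrt t ^ r" for r
    using Beta_half_scaled(2)[OF t p[of r]] sqrt_power_powr'[OF t, of r]
    unfolding set_lebesgue_integral_def by simp
  have f: "integrable lborel (?f r)" for r using h by simp
  have coeff: "?c r * (Beta (?p r) (1/2) * sqrt t ^ r) = sqrt pi * (b (Suc r) * sqrt t ^ r / Gamma (real r / 2 + 1))" for r
  proof -
    have "?p r + 1/2 = real r / 2 + 1" by (simp add: field_simps)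
    then show ?thesis using Gp[of r] less_imp_neq[OF Gp[of r]] by (simp add: Beta_def Gamma_one_half_real)
  qed
  have int_f: "integral\<^sup>L lborel (?f r) = sqrt pi * (b (Suc r) * sqrt t ^ r / Gamma (real r / 2 + 1))" for r
    by (subst integral_mult_right_zero, subst int_h, rule coeff)
  \<comment> \<open>Each \<open>?h r\<close> is nonnegative, so the interchange of sum and integral
    reduces to absolute convergence of the shifted series.\<close>
  have norm_f: "(\<integral>s. norm (?f r s) \<partial>lborel) = sqrt pi * \<bar>b (Suc r) * sqrt t ^ r / Gamma (real r / 2 + 1)\<bar>" for r
  proof -
    have "(\<integral>s. norm (?f r s) \<partial>lborel) = (\<integral>s. \<bar>?c r\<bar> * ?h r s \<partial>lborel)"
      by (intro Bochner_Integration.integral_cong) (auto simp: abs_mult indicator_def)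
    also have "\<dots> = \<bar>?c r\<bar> * (Beta (?p r) (1/2) * sqrt t ^ r)"
      by (subst integral_mult_right_zero, subst int_h) simp
    also have "\<dots> = \<bar>?c r * (Beta (?p r) (1/2) * sqrt t ^ r)\<bar>"
      using Gamma_half_shift_pos[of r] Gp[of r] p[of r] t by (simp add: abs_mult Beta_def Gamma_one_half_real add_divide_distrib[symmetric])
    finally show ?thesis unfolding coeff by (simp add: abs_mult)
  qed
  have sum_norm: "summable (\<lambda>r. \<integral>s. norm (?f r s) \<partial>lborel)"
    unfolding norm_f by (intro summable_mult ml_series_abs_summable geometric_growth_Suc b)
  have term_eq: "?f r s = indicator {0<..<t} s * (t - s) powr (-1/2) * (b (Suc r) * (sqrt s ^ r / sqrt s) / Gamma (?p r))" for r s
    by (cases "s > 0") (auto simp: sqrt_power_powr indicator_def)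
  have "summable (\<lambda>r. norm (?f r s))" for s
  proof (cases "0 < s \<and> s < t")
    case True
    \<comment> \<open>Convergence at the larger point \<open>sqrt s + 1\<close> forces absolute
      convergence at \<open>sqrt s\<close>.\<close>
    have "summable (\<lambda>r. \<bar>diffs (\<lambda>r. b r / Gamma (real r / 2 + 1)) r * sqrt s ^ r\<bar>)"
      using powser_insidea[of "diffs (\<lambda>r. b r / Gamma (real r / 2 + 1))" "sqrt s + 1" "sqrt s"]
        termdiff_converges_all[of "\<lambda>r. b r / Gamma (real r / 2 + 1)" "sqrt s + 1"] ml_series_summable[OF b] True
      by (simp add: abs_mult)
    then have "summable (\<lambda>r. \<bar>b (Suc r) * sqrt s ^ r / Gamma (?p r)\<bar>)"
      unfolding diffs_ml_coeffs abs_mult[of 2] by (subst (asm) summable_cmult_iff) simp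
    from summable_mult[OF this, of "\<bar>(t - s) powr (-1/2) / sqrt s\<bar>"]
    show ?thesis unfolding term_eq using True by (simp add: abs_mult mult_ac)
  qed (auto simp: indicator_def)
  then have AE_norm: "AE s in lborel. summable (\<lambda>r. norm (?f r s))" by simp
  have int_eq: "indicator {0<..<t} s *\<^sub>R caputo_half_integrand u t s = (\<Sum>r. ?f r s)" for s
  proof (cases "0 < s \<and> s < t")
    case True
    have "summable (\<lambda>r. b (Suc r) * (sqrt s ^ r / sqrt s) / Gamma (?p r))"
      using summable_divide[OF ml_series_deriv_summable[OF b, of "sqrt s"], of "sqrt s"] by (simp add: mult_ac)
    from suminf_mult[OF this, of "(t - s) powr (-1/2)"] show ?thesis
      unfolding term_eq caputo_half_integrand_def using True by (simp add: DERIV_imp_deriv[OF deriv])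
  qed (auto simp: indicator_def)
  show "set_integrable lborel {0<..<t} (caputo_half_integrand u t)"
    unfolding set_integrable_def int_eq by (rule integrable_suminf[OF f AE_norm sum_norm])
  have "(LBINT s:{0<..<t}. caputo_half_integrand u t s) = (\<Sum>r. integral\<^sup>L lborel (?f r))"
    unfolding set_lebesgue_integral_def int_eq by (rule integral_suminf[OF f AE_norm sum_norm])
  also have "\<dots> = sqrt pi * ml_series (\<lambda>r. b (Suc r)) (sqrt t)"
    unfolding int_f ml_series_def
    by (intro suminf_mult ml_series_summable geometric_growth_Suc b)
  finally show "caputo_half u t = ml_series (\<lambda>r. b (Suc r)) (sqrt t)"
    by (simp add: caputo_half_def Gamma_one_half_real)
qed

text \<open>The constant \<open>d\<close> disappears under both derivatives, and the recursion
  expresses the series shifted by two through the one shifted by one and the series itself, which is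
  u - d.\<close>

lemma ml_series_fractional_ode:
  fixes b :: "nat \<Rightarrow> real" and u :: "real \<Rightarrow> real"
  assumes b: "geometric_growth b"
    and u: "\<And>t. t > 0 \<Longrightarrow> u t = d + ml_series b (sqrt t)"
    and rec: "\<And>r. b (Suc (Suc r)) + p * b (Suc r) + q * b r = 0"
    and t: "t > 0"
  shows "u differentiable (at t)"
    and "set_integrable lborel {0<..<t} (caputo_half_integrand u t)"
    and "deriv u t + p * caputo_half u t = q * (d - u t) + b 1 / sqrt (pi * t)"
proof -
  have deriv: "(u has_real_derivative
      (\<Sum>r. b (Suc r) * (sqrt s ^ r / sqrt s) / Gamma ((real r + 1) / 2))) (at s)" if "s > 0" for s
  proof -
    have "((\<lambda>t. d + ml_series b (sqrt t)) has_real_derivative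
      (\<Sum>r. b (Suc r) * (sqrt s ^ r / sqrt s) / Gamma ((real r + 1) / 2))) (at s)"
      using DERIV_add[OF DERIV_const has_derivative_ml_series_sqrt(1)[OF b that]] by simp
    then show ?thesis
      by (rule has_field_derivative_transform_within_open[where S = "{0<..}"]) (use that u in auto)
  qed
  show "u differentiable (at t)"
    using deriv[OF t] real_differentiable_def by blast
  show "set_integrable lborel {0<..<t} (caputo_half_integrand u t)"
    by (rule caputo_half_ml_series[OF b t deriv])
  have "deriv u t = b 1 / sqrt (pi * t) + ml_series (\<lambda>r. b (Suc (Suc r))) (sqrt t)"
    using DERIV_imp_deriv[OF deriv[OF t]] has_derivative_ml_series_sqrt(2)[OF b t] by simp
  moreover have "caputo_half u t = ml_series (\<lambda>r. b (Suc r)) (sqrt t)"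
    by (rule caputo_half_ml_series[OF b t deriv])
  moreover have "(\<lambda>r. b (Suc (Suc r))) = (\<lambda>r. (- p) * b (Suc r) + (- q) * b r)"
    using rec by (auto simp: fun_eq_iff add_eq_0_iff algebra_simps)
  then have "ml_series (\<lambda>r. b (Suc (Suc r))) (sqrt t) =
      - p * ml_series (\<lambda>r. b (Suc r)) (sqrt t) + - q * ml_series b (sqrt t)"
    using b by (simp only: ml_series_add ml_series_cmult geometric_growth_cmult geometric_growth_Suc)
  ultimately show "deriv u t + p * caputo_half u t = q * (d - u t) + b 1 / sqrt (pi * t)"
    using u[OF t] by (simp add: algebra_simps)
qed

subsection \<open>The scaled complementary error function\<close>

text \<open>Defined by the Mittag-Leffler series, so that the closed forms need no conversion; its
  Gaussian nature is recovered from its differential equation.\<close>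

definition erfcx :: "real \<Rightarrow> real" where
  "erfcx x = mittag_leffler (1/2) 1 (- x)"

lemma DERIV_erfcx [derivative_intros]:
  assumes "(f has_real_derivative f') (at x)"
  shows "((\<lambda>x. erfcx (f x)) has_real_derivative (2 * f x * erfcx (f x) - 2 / sqrt pi) * f') (at x)"
  using DERIV_chain2[OF DERIV_mittag_leffler_half DERIV_minus[OF assms]]
  by (simp add: erfcx_def algebra_simps)

lemma erfcx_0: "erfcx 0 = 1"
  using ml_series_0[of "\<lambda>_. 1"] by (simp add: erfcx_def mittag_leffler_half_one')

text \<open>The product is erfc x: exp(-x^2) is an integrating factor for the equation of
  \<open>erfcx\<close>.\<close>

lemma DERIV_gauss_erfcx:
  "((\<lambda>x. exp (- x\<^sup>2) * erfcx x) has_real_derivative - (2 / sqrt pi * exp (- x\<^sup>2))) (at x)"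
  by (auto intro!: derivative_eq_intros simp: algebra_simps)

text \<open>By the fundamental theorem the product is 1 - 2 / sqrt pi times the integral of
  exp(-y^2) over [0, x], and the half-line Gaussian integral is sqrt pi / 2.\<close>

lemma gauss_erfcx_tendsto_0: "((\<lambda>x. exp (- x\<^sup>2) * erfcx x) \<longlongrightarrow> 0) at_top"
proof -
  define V where "V = (\<lambda>x. exp (- x\<^sup>2) * erfcx x)"
  let ?g = "\<lambda>x. indicator {0..} x *\<^sub>R exp (- x\<^sup>2) :: real"
  have lim: "((\<lambda>x. \<integral>y. indicator {..x} y *\<^sub>R ?g y \<partial>lborel) \<longlongrightarrow> (\<integral>y. ?g y \<partial>lborel)) at_top"
    using gaussian_moment_0 by (intro tendsto_integral_at_top) (auto simp: has_bochner_integral_iff)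
  have total: "(\<integral>y. ?g y \<partial>lborel) = sqrt pi / 2"
    using gaussian_moment_0 by (simp add: has_bochner_integral_iff)
  have "eventually (\<lambda>x. (\<integral>y. indicator {..x} y *\<^sub>R ?g y \<partial>lborel) = sqrt pi / 2 * (1 - V x)) at_top"
    using eventually_ge_at_top[of 0]
  proof eventually_elim
    case (elim x)
    have "(\<integral>y. indicator {..x} y *\<^sub>R ?g y \<partial>lborel) = (\<integral>y. exp (- y\<^sup>2) * indicator {0..x} y \<partial>lborel)"
      by (intro Bochner_Integration.integral_cong) (auto simp: indicator_def)
    also have "\<dots> = - (sqrt pi / 2) * V x - (- (sqrt pi / 2) * V 0)"
    proof (rule integral_FTC_Icc_real[OF elim])
      fix y
      show "((\<lambda>y. - (sqrt pi / 2) * V y) has_real_derivative exp (- y\<^sup>2)) (at y)"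
        using DERIV_cmult[OF DERIV_gauss_erfcx, of "- (sqrt pi / 2)" y] by (simp add: V_def)
    qed auto
    finally show ?case by (simp add: V_def erfcx_0 algebra_simps)
  qed
  with lim[unfolded total] have "((\<lambda>x. sqrt pi / 2 * (1 - V x)) \<longlongrightarrow> sqrt pi / 2) at_top"
    by (rule Lim_transform_eventually)
  then have "((\<lambda>x. 1 - 2 / sqrt pi * (sqrt pi / 2 * (1 - V x))) \<longlongrightarrow> 1 - 2 / sqrt pi * (sqrt pi / 2)) at_top"
    by (intro tendsto_intros)
  moreover have "1 - 2 / sqrt pi * (sqrt pi / 2 * (1 - y)) = y" for y by (simp add: field_simps)
  ultimately show ?thesis by (simp only: V_def) simp
qed

text \<open>\<open>f x\<close> bounds every later value, hence also the limit 0. It supplies both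
  bounds on \<open>erfcx\<close> and the sign of antiderivatives that vanish at infinity.\<close>

lemma nonincreasing_tendsto_0_imp_nonneg:
  fixes f :: "real \<Rightarrow> real"
  assumes "\<And>y. x \<le> y \<Longrightarrow> \<exists>d. (f has_real_derivative d) (at y) \<and> d \<le> 0" "(f \<longlongrightarrow> 0) at_top"
  shows "f x \<ge> 0"
proof (rule tendsto_upperbound[OF assms(2)])
  show "eventually (\<lambda>y. f y \<le> f x) at_top"
    using eventually_ge_at_top[of x]
    by eventually_elim (rule DERIV_nonpos_imp_nonincreasing, auto intro: assms(1))
qed (rule trivial_limit_at_top_linorder)

text \<open>\<open>ennreal\<close> sends negative numbers to 0, so the sign of \<open>F a\<close> is
  recorded for the return to real values.\<close>

lemma nn_integral_FTC_atLeast_0: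
  fixes f F :: "real \<Rightarrow> real"
  assumes "f \<in> borel_measurable borel"
    and F: "\<And>x. a \<le> x \<Longrightarrow> (F has_real_derivative f x) (at x)"
    and f: "\<And>x. a \<le> x \<Longrightarrow> f x \<ge> 0"
    and lim: "(F \<longlongrightarrow> 0) at_top"
  shows "(\<integral>\<^sup>+ x. ennreal (f x) * indicator {a..} x \<partial>lborel) = ennreal (- F a)" and "F a \<le> 0"
proof -
  show "(\<integral>\<^sup>+ x. ennreal (f x) * indicator {a..} x \<partial>lborel) = ennreal (- F a)"
    using nn_integral_FTC_atLeast[OF assms] by simp
  have "- F a \<ge> 0"
  proof (rule nonincreasing_tendsto_0_imp_nonneg[where f = "\<lambda>x. - F x"])
    show "\<exists>d. ((\<lambda>x. - F x) has_real_derivative d) (at y) \<and> d \<le> 0" if "a \<le> y" for y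
      using DERIV_minus[OF F[OF that]] f[OF that] by (intro exI[of _ "- f y"]) simp
    show "((\<lambda>x. - F x) \<longlongrightarrow> 0) at_top" using tendsto_minus[OF lim] by simp
  qed
  then show "F a \<le> 0" by simp
qed

lemma erfcx_nonneg: "erfcx x \<ge> 0"
proof -
  have "exp (- x\<^sup>2) * erfcx x \<ge> 0"
    by (rule nonincreasing_tendsto_0_imp_nonneg[OF _ gauss_erfcx_tendsto_0])
      (intro exI conjI, rule DERIV_gauss_erfcx, simp)
  then show ?thesis by (simp add: zero_le_mult_iff)
qed

text \<open>exp(-x^2) - erfc x tends to 0 and has derivative exp(-x^2) (2 / sqrt pi - 2 x),
  nonpositive from x = 1 on because sqrt pi >= 1. The bound controls \<open>elastic_tail\<close> at
  infinity.\<close>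

lemma erfcx_le_1:
  assumes "x \<ge> 1"
  shows "erfcx x \<le> 1"
proof -
  have "exp (- x\<^sup>2) - exp (- x\<^sup>2) * erfcx x \<ge> 0"
  proof (rule nonincreasing_tendsto_0_imp_nonneg[where f = "\<lambda>x. exp (- x\<^sup>2) - exp (- x\<^sup>2) * erfcx x"])
    fix y assume "x \<le> y"
    have "((\<lambda>x. exp (- x\<^sup>2) - exp (- x\<^sup>2) * erfcx x) has_real_derivative
      exp (- y\<^sup>2) * (- (2 * y)) - - (2 / sqrt pi * exp (- y\<^sup>2))) (at y)"
      by (intro DERIV_diff DERIV_gauss_erfcx) (auto intro!: derivative_eq_intros)
    moreover have "sqrt pi \<ge> 1" using pi_ge_two by (intro real_le_rsqrt) simp
    then have "2 / sqrt pi \<le> 2 * y" using assms \<open>x \<le> y\<close> by (simp add: divide_simps mult_ge1_I)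
    then have "exp (- y\<^sup>2) * (- (2 * y)) - - (2 / sqrt pi * exp (- y\<^sup>2)) \<le> 0"
      using mult_left_mono[of "2 / sqrt pi" "2 * y" "exp (- y\<^sup>2)"] by (simp add: mult_ac)
    ultimately show "\<exists>d. ((\<lambda>x. exp (- x\<^sup>2) - exp (- x\<^sup>2) * erfcx x) has_real_derivative d) (at y) \<and> d \<le> 0"
      by blast
  next
    have "((\<lambda>x::real. exp (- x\<^sup>2)) \<longlongrightarrow> 0) at_top" by real_asymp
    from tendsto_diff[OF this gauss_erfcx_tendsto_0]
    show "((\<lambda>x. exp (- x\<^sup>2) - exp (- x\<^sup>2) * erfcx x) \<longlongrightarrow> 0) at_top" by simp
  qed
  then have "exp (- x\<^sup>2) * erfcx x \<le> exp (- x\<^sup>2) * 1" by simp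
  then show ?thesis by (subst (asm) mult_le_cancel_left_pos) auto
qed

subsection \<open>The elastic law\<close>

definition gauss_density :: "real \<Rightarrow> real \<Rightarrow> real" where
  "gauss_density t s = exp (- s\<^sup>2 / (2 * t)) / sqrt (2 * pi * t)"

text \<open>For t > 0, expanding the square gives exp(a s + a^2 t / 2) erfc((s + a t) / sqrt(2 t));
  at s = 0 this is one minus the atom.\<close>

definition elastic_tail :: "real \<Rightarrow> real \<Rightarrow> real \<Rightarrow> real" where
  "elastic_tail a t s = exp (- s\<^sup>2 / (2 * t)) * erfcx ((s + a * t) / sqrt (2 * t))"

lemma DERIV_gauss_density [derivative_intros]:
  assumes "t > 0" "(f has_real_derivative f') (at s)"
  shows "((\<lambda>s. gauss_density t (f s)) has_real_derivative - (f s / t * gauss_density t (f s)) * f') (at s)"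
proof -
  have "(gauss_density t has_real_derivative - (x / t * gauss_density t x)) (at x)" for x
    unfolding gauss_density_def using assms(1) by (auto intro!: derivative_eq_intros simp: field_simps)
  from DERIV_chain2[OF this assms(2)] show ?thesis .
qed

text \<open>With z the argument of \<open>erfcx\<close>, the chain rule gives 2 z / sqrt(2 t) = s/t
  + a; the part s/t cancels against the derivative of the Gaussian factor and a remains.\<close>

lemma DERIV_elastic_tail [derivative_intros]:
  assumes t: "t > 0" and f: "(f has_real_derivative f') (at s)"
  shows "((\<lambda>s. elastic_tail a t (f s)) has_real_derivative (a * elastic_tail a t (f s) - 2 * gauss_density t (f s)) * f') (at s)"
proof -
  have "(elastic_tail a t has_real_derivative a * elastic_tail a t x - 2 * gauss_density t x) (at x)" for x
  proof -
    let ?z = "(x + a * t) / sqrt (2 * t)"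
    have "(elastic_tail a t has_real_derivative
      exp (- x\<^sup>2 / (2 * t)) * ((2 * ?z * erfcx ?z - 2 / sqrt pi) * (1 / sqrt (2 * t)))
      + exp (- x\<^sup>2 / (2 * t)) * (- x / t) * erfcx ?z) (at x)"
      unfolding elastic_tail_def[abs_def] using t by (auto intro!: derivative_eq_intros simp: field_simps)
    also have "exp (- x\<^sup>2 / (2 * t)) * ((2 * ?z * erfcx ?z - 2 / sqrt pi) * (1 / sqrt (2 * t)))
      + exp (- x\<^sup>2 / (2 * t)) * (- x / t) * erfcx ?z
      = a * elastic_tail a t x - 2 * gauss_density t x"
    proof -
      have z: "2 * ?z * (1 / sqrt (2 * t)) = x / t + a" using t by (simp add: field_simps)
      have p: "2 / sqrt pi * (1 / sqrt (2 * t)) = 2 / sqrt (2 * pi * t)" by (simp add: real_sqrt_mult)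
      have "exp (- x\<^sup>2 / (2 * t)) * ((2 * ?z * erfcx ?z - 2 / sqrt pi) * (1 / sqrt (2 * t)))
        = exp (- x\<^sup>2 / (2 * t)) * (2 * ?z * (1 / sqrt (2 * t)) * erfcx ?z - 2 / sqrt pi * (1 / sqrt (2 * t)))"
        by (simp add: algebra_simps)
      also have "\<dots> = exp (- x\<^sup>2 / (2 * t)) * ((x / t + a) * erfcx ?z - 2 / sqrt (2 * pi * t))"
        unfolding z p ..
      finally show ?thesis unfolding elastic_tail_def gauss_density_def
        by (simp add: algebra_simps)
    qed
    finally show ?thesis .
  qed
  from DERIV_chain2[OF this f] show ?thesis .
qed

lemma elastic_tail_nonneg: "elastic_tail a t s \<ge> 0"
  by (simp add: elastic_tail_def erfcx_nonneg)

text \<open>The weight \<open>g\<close> is free because constants, exponentials and s times an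
  exponential all occur. Once s >= sqrt(2 t), the argument of \<open>erfcx\<close> is at least 1 and
  the Gaussian factor dominates.\<close>

lemma elastic_tail_tendsto_0:
  assumes "t > 0" "a > 0" and g: "((\<lambda>s. g s * exp (- s\<^sup>2 / (2 * t))) \<longlongrightarrow> 0) at_top"
  shows "((\<lambda>s. g s * elastic_tail a t s) \<longlongrightarrow> 0) at_top"
proof (rule Lim_null_comparison[OF _ tendsto_rabs_zero[OF g]])
  show "eventually (\<lambda>s. norm (g s * elastic_tail a t s) \<le> \<bar>g s * exp (- s\<^sup>2 / (2 * t))\<bar>) at_top"
    using eventually_ge_at_top[of "sqrt (2 * t)"]
  proof eventually_elim
    case (elim s)
    have "sqrt (2 * t) \<le> s + a * t" using elim assms by (simp add: add_increasing2)
    then have "erfcx ((s + a * t) / sqrt (2 * t)) \<le> 1" using assms by (intro erfcx_le_1) simp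
    then show ?case
      using mult_left_mono[of "erfcx ((s + a * t) / sqrt (2 * t))" 1 "\<bar>g s\<bar> * exp (- s\<^sup>2 / (2 * t))"]
        erfcx_nonneg[of "(s + a * t) / sqrt (2 * t)"]
      by (simp add: elastic_tail_def abs_mult mult_ac)
  qed
qed

text \<open>The closed form is -T', with T the tail. Nonnegativity is read off the defining
  integral, since the difference does not show it.\<close>

lemma elastic_density_eq:
  assumes t: "t > 0" and a: "a > 0" and s: "s \<ge> 0"
  shows "elastic_density a t s = 2 * gauss_density t s - a * elastic_tail a t s"
    and "elastic_density a t s \<ge> 0"
proof -
  define f where "f w = w * exp (- a * w) * (exp (- (w\<^sup>2) / (2 * t)) / sqrt (2 * pi * t ^ 3))" for w
  \<comment> \<open>Integration by parts with w phi_t(w) / t = -phi_t'(w); the remaining integral is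
    supplied by exp(-a w) T(w) / 2, whose derivative is -exp(-a w) phi_t(w).\<close>
  define A where "A w = exp (- a * w) * (a * elastic_tail a t w / 2 - gauss_density t w)" for w
  have f_eq: "f w = exp (- a * w) * (w / t * gauss_density t w)" for w
  proof -
    have "sqrt (2 * pi * t ^ 3) = t * sqrt (2 * pi * t)"
      using t by (simp add: power3_eq_cube real_sqrt_mult)
    then show ?thesis by (simp add: f_def gauss_density_def mult_ac)
  qed
  have [measurable]: "f \<in> borel_measurable borel" unfolding f_def by measurable
  have f_nonneg: "f w \<ge> 0" if "w \<ge> 0" for w using that t by (simp add: f_def)
  have A': "(A has_real_derivative f w) (at w)" for w
    unfolding f_eq A_def using t by (auto intro!: derivative_eq_intros simp: field_simps)
  have A_lim: "(A \<longlongrightarrow> 0) at_top"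
  proof -
    have 1: "((\<lambda>w. exp (- a * w) * exp (- w\<^sup>2 / (2 * t))) \<longlongrightarrow> 0) at_top"
      using a t by real_asymp
    have "((\<lambda>w. a / 2 * (exp (- a * w) * elastic_tail a t w) - exp (- a * w) * exp (- w\<^sup>2 / (2 * t)) / sqrt (2 * pi * t)) \<longlongrightarrow> a / 2 * 0 - 0 / sqrt (2 * pi * t)) at_top"
      using t by (intro tendsto_intros elastic_tail_tendsto_0[OF t a] 1) auto
    moreover have "A = (\<lambda>w. a / 2 * (exp (- a * w) * elastic_tail a t w) - exp (- a * w) * exp (- w\<^sup>2 / (2 * t)) / sqrt (2 * pi * t))"
      by (simp add: fun_eq_iff A_def gauss_density_def algebra_simps)
    ultimately show ?thesis by simp
  qed
  have FTC: "(\<integral>\<^sup>+ w. ennreal (f w) * indicator {s..} w \<partial>lborel) = ennreal (- A s)" "A s \<le> 0"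
    using nn_integral_FTC_atLeast_0[OF _ A' _ A_lim, of s] s f_nonneg by auto
  have "integral\<^sup>L lborel (\<lambda>w. indicator {s<..} w *\<^sub>R f w) =
      enn2real (\<integral>\<^sup>+ w. ennreal (indicator {s<..} w *\<^sub>R f w) \<partial>lborel)"
    using s f_nonneg by (intro integral_eq_nn_integral) (auto simp: indicator_def)
  also have "(\<integral>\<^sup>+ w. ennreal (indicator {s<..} w *\<^sub>R f w) \<partial>lborel) = ennreal (- A s)"
    unfolding FTC(1)[symmetric]
    using AE_lborel_singleton[of s] by (intro nn_integral_cong_AE) (auto elim!: eventually_mono simp: indicator_def)
  finally have "integral\<^sup>L lborel (\<lambda>w. indicator {s<..} w *\<^sub>R f w) = - A s"
    using FTC(2) by simp
  then have "elastic_density a t s = 2 * exp (a * s) * (- A s)"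
    unfolding elastic_density_def set_lebesgue_integral_def f_def by simp
  also have "\<dots> = 2 * gauss_density t s - a * elastic_tail a t s"
    by (simp add: A_def algebra_simps exp_minus)
  finally show "elastic_density a t s = 2 * gauss_density t s - a * elastic_tail a t s" .
  show "elastic_density a t s \<ge> 0"
    unfolding elastic_density_def set_lebesgue_integral_def using s t
    by (intro mult_nonneg_nonneg Bochner_Integration.integral_nonneg) (auto simp: indicator_def)
qed

text \<open>As u > 0, the half-line misses the atom at 0, and -T is an antiderivative of the density
  that vanishes at infinity.\<close>

lemma emeasure_elastic_law_atLeast:
  assumes Y: "has_elastic_law M a t Y" and t: "t > 0" and a: "a > 0" and u: "u > 0"
  shows "emeasure (distr M borel Y) {u..} = ennreal (elastic_tail a t u)"
proof -
  let ?f = "\<lambda>s. 2 * gauss_density t s - a * elastic_tail a t s"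
  have "emeasure (distr M borel Y) {u..} = (\<integral>\<^sup>+ s \<in> {u..} \<inter> {0..}. ennreal (elastic_density a t s) \<partial>lborel)"
    using Y u unfolding has_elastic_law_def by simp
  also have "\<dots> = (\<integral>\<^sup>+ s. ennreal (?f s) * indicator {u..} s \<partial>lborel)"
    using u by (intro nn_integral_cong) (auto simp: indicator_def elastic_density_eq(1)[OF t a])
  also have "\<dots> = ennreal (- (- elastic_tail a t u))"
  proof (rule nn_integral_FTC_atLeast_0(1))
    show "?f \<in> borel_measurable borel"
      using t by (intro borel_measurable_continuous_onI continuous_at_imp_continuous_on ballI DERIV_isCont)
        (auto intro!: derivative_eq_intros)
    show "((\<lambda>s. - elastic_tail a t s) has_real_derivative ?f s) (at s)" for s
      using t by (auto intro!: derivative_eq_intros)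
    show "0 \<le> ?f s" if "u \<le> s" for s
      using elastic_density_eq[OF t a, of s] that u by simp
    have "((\<lambda>s. 1 * exp (- s\<^sup>2 / (2 * t))) \<longlongrightarrow> 0) at_top"
      using t by real_asymp
    from tendsto_minus[OF elastic_tail_tendsto_0[OF t a this]]
    show "((\<lambda>s. - elastic_tail a t s) \<longlongrightarrow> 0) at_top" by simp
  qed
  finally show ?thesis by simp
qed

subsection \<open>The crossing probability\<close>

text \<open>Fubini for the complement U <= Y: given U = u, its probability is the tail of Y at u.
  \<open>T\<close> and \<open>c\<close> stay abstract to serve equal and unequal rates
  alike.\<close>

lemma (in prob_space) prob_less_exponential:
  assumes U: "distributed M lborel U (exponential_density l)" and l: "l > 0"
    and YU: "indep_var borel Y borel U"
    and tail: "\<And>u. u > 0 \<Longrightarrow> emeasure (distr M borel Y) {u..} = ennreal (T u)"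
    and I: "(\<integral>\<^sup>+ u. ennreal (l * exp (- l * u) * T u) * indicator {0..} u \<partial>lborel) = ennreal c" "c \<ge> 0"
  shows "prob {\<omega> \<in> space M. Y \<omega> < U \<omega>} = 1 - c"
proof -
  have [measurable]: "Y \<in> borel_measurable M" "U \<in> borel_measurable M"
    and joint: "distr M borel Y \<Otimes>\<^sub>M distr M borel U = distr M (borel \<Otimes>\<^sub>M borel) (\<lambda>x. (Y x, U x))"
    using YU unfolding indep_var_distribution_eq by auto
  have dU: "distr M borel U = density lborel (exponential_density l)"
    using distributed_distr_eq_density[OF U] by (simp cong: distr_cong)
  interpret Y: prob_space "distr M borel Y" by (rule prob_space_distr) simp
  interpret U: prob_space "distr M borel U" by (rule prob_space_distr) simp
  interpret P: pair_sigma_finite "distr M borel Y" "distr M borel U" ..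
  define A :: "(real \<times> real) set" where "A = {p. snd p \<le> fst p}"
  have A [measurable]: "A \<in> sets (borel \<Otimes>\<^sub>M borel)"
    unfolding A_def borel_prod by (intro borel_closed closed_Collect_le continuous_intros)
  have "emeasure M {\<omega> \<in> space M. U \<omega> \<le> Y \<omega>} = emeasure (distr M (borel \<Otimes>\<^sub>M borel) (\<lambda>x. (Y x, U x))) A"
    by (subst emeasure_distr[OF _ A]) (auto intro!: arg_cong[where f = "emeasure M"] simp: A_def)
  also have "\<dots> = (\<integral>\<^sup>+ u. emeasure (distr M borel Y) ((\<lambda>y. (y, u)) -` A) \<partial>distr M borel U)"
    unfolding joint[symmetric] by (rule P.emeasure_pair_measure_alt2) simp
  also have "\<dots> = (\<integral>\<^sup>+ u. emeasure (distr M borel Y) {u..} \<partial>density lborel (exponential_density l))"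
    unfolding dU by (intro nn_integral_cong arg_cong2[where f = emeasure]) (auto simp: A_def)
  also have "\<dots> = (\<integral>\<^sup>+ u. ennreal (exponential_density l u) * emeasure (distr M borel Y) {u..} \<partial>lborel)"
  proof (rule nn_integral_density)
    have "(\<lambda>u. emeasure (distr M borel Y) ((\<lambda>y. (y, u)) -` A)) \<in> borel_measurable (distr M borel U)"
      by (rule P.measurable_emeasure_Pair2) simp
    moreover have "(\<lambda>y. (y, u)) -` A = {u..}" for u by (auto simp: A_def)
    ultimately show "(\<lambda>u. emeasure (distr M borel Y) {u..}) \<in> borel_measurable lborel" by simp
  qed simp
  also have "\<dots> = (\<integral>\<^sup>+ u. ennreal (l * exp (- l * u) * T u) * indicator {0..} u \<partial>lborel)"
  proof (rule nn_integral_cong_AE)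
    \<comment> \<open>The tail formula is available for u > 0, away from the atom; the point 0 is a
      null set.\<close>
    show "AE u in lborel. ennreal (exponential_density l u) * emeasure (distr M borel Y) {u..} =
        ennreal (l * exp (- l * u) * T u) * indicator {0..} u"
      using AE_lborel_singleton[of 0]
    proof eventually_elim
      case (elim u)
      show ?case
      proof (cases "u > 0")
        case True
        then show ?thesis using l ennreal_mult'[of "l * exp (- l * u)" "T u"]
          by (simp add: tail exponential_density_def erlang_density_def mult.commute)
      qed (use elim in \<open>simp add: exponential_density_def erlang_density_def\<close>)
    qed
  qed
  finally have "emeasure M {\<omega> \<in> space M. U \<omega> \<le> Y \<omega>} = ennreal c" using I by simp
  then have "prob {\<omega> \<in> space M. U \<omega> \<le> Y \<omega>} = c" using I(2) by (simp add: measure_def)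
  moreover have "prob {\<omega> \<in> space M. Y \<omega> < U \<omega>} = 1 - prob {\<omega> \<in> space M. U \<omega> \<le> Y \<omega>}"
    by (subst prob_compl[symmetric]) (auto intro!: arg_cong[where f = prob] simp: not_le)
  ultimately show ?thesis by simp
qed

section \<open>Laplace transform of the tail, for unequal and for equal rates\<close>

lemma nn_integral_elastic_tail_neq:
  assumes "t > 0" "a > 0" "l > 0" "l \<noteq> a"
  shows "(\<integral>\<^sup>+ u. ennreal (l * exp (- l * u) * elastic_tail a t u) * indicator {0..} u \<partial>lborel)
    = ennreal (l / (l - a) * (elastic_tail a t 0 - elastic_tail l t 0))"
    and "l / (l - a) * (elastic_tail a t 0 - elastic_tail l t 0) \<ge> 0"
proof -
  \<comment> \<open>The tails with rates a and l obey equations with the same term -2 phi_t, so it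
    cancels in the difference: exp(-l u) (T_a - T_l) has derivative -(l - a) exp(-l u) T_a.\<close>
  let ?F = "\<lambda>u. - (l / (l - a)) * (exp (- l * u) * elastic_tail a t u - exp (- l * u) * elastic_tail l t u)"
  let ?f = "\<lambda>u. l * exp (- l * u) * elastic_tail a t u"
  have f: "?f \<in> borel_measurable borel"
    using assms by (intro borel_measurable_continuous_onI continuous_at_imp_continuous_on ballI DERIV_isCont)
      (auto intro!: derivative_eq_intros)
  have F': "(?F has_real_derivative ?f u) (at u)" for u
  proof -
    have D: "((\<lambda>u. exp (- l * u) * elastic_tail a t u - exp (- l * u) * elastic_tail l t u) has_real_derivative
        - (l - a) * (exp (- l * u) * elastic_tail a t u)) (at u)"
      using assms by (auto intro!: derivative_eq_intros simp: algebra_simps)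
    have "- (l / (l - a)) * (- (l - a) * (exp (- l * u) * elastic_tail a t u)) = ?f u"
      using assms by (simp add: field_simps)
    with DERIV_cmult[OF D, of "- (l / (l - a))"] show ?thesis by (simp only:)
  qed
  have lim: "((\<lambda>s. exp (- l * s) * exp (- s\<^sup>2 / (2 * t))) \<longlongrightarrow> 0) at_top"
    using assms by real_asymp
  have "(?F \<longlongrightarrow> - (l / (l - a)) * (0 - 0)) at_top"
    using assms by (intro tendsto_intros elastic_tail_tendsto_0 lim)
  then have "(?F \<longlongrightarrow> 0) at_top" by simp
  from nn_integral_FTC_atLeast_0[OF f F' _ this, of 0]
  show "(\<integral>\<^sup>+ u. ennreal (l * exp (- l * u) * elastic_tail a t u) * indicator {0..} u \<partial>lborel)
    = ennreal (l / (l - a) * (elastic_tail a t 0 - elastic_tail l t 0))"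
    "l / (l - a) * (elastic_tail a t 0 - elastic_tail l t 0) \<ge> 0"
    using assms elastic_tail_nonneg by simp_all
qed

lemma nn_integral_elastic_tail_eq:
  assumes "t > 0" "l > 0"
  shows "(\<integral>\<^sup>+ u. ennreal (l * exp (- l * u) * elastic_tail l t u) * indicator {0..} u \<partial>lborel)
    = ennreal (l * (2 * t * gauss_density t 0 - l * t * elastic_tail l t 0))"
    and "l * (2 * t * gauss_density t 0 - l * t * elastic_tail l t 0) \<ge> 0"
proof -
  \<comment> \<open>As exp(-l u) T has derivative -2 exp(-l u) phi_t, the product with u leaves the
    error -2 u exp(-l u) phi_t. The second term removes it through u phi_t = -t phi_t', and the
    third removes the multiple of exp(-l u) phi_t that this creates.\<close>
  let ?F = "\<lambda>u. l * (u * exp (- l * u) * elastic_tail l t u - 2 * t * (exp (- l * u) * gauss_density t u)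
    + l * t * (exp (- l * u) * elastic_tail l t u))"
  let ?f = "\<lambda>u. l * exp (- l * u) * elastic_tail l t u"
  have f: "?f \<in> borel_measurable borel"
    using assms by (intro borel_measurable_continuous_onI continuous_at_imp_continuous_on ballI DERIV_isCont)
      (auto intro!: derivative_eq_intros)
  have F': "(?F has_real_derivative ?f u) (at u)" for u
    using assms by (auto intro!: derivative_eq_intros simp: algebra_simps)
  have lim: "((\<lambda>s. exp (- l * s) * exp (- s\<^sup>2 / (2 * t))) \<longlongrightarrow> 0) at_top"
    and lim': "((\<lambda>s. s * exp (- l * s) * exp (- s\<^sup>2 / (2 * t))) \<longlongrightarrow> 0) at_top"
    using assms by real_asymp+
  have lim'': "((\<lambda>s. exp (- l * s) * gauss_density t s) \<longlongrightarrow> 0) at_top"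
    using tendsto_divide[OF lim tendsto_const[of "sqrt (2 * pi * t)"]] assms by (simp add: gauss_density_def)
  have "(?F \<longlongrightarrow> l * (0 - 2 * t * 0 + l * t * 0)) at_top"
    using assms by (intro tendsto_intros elastic_tail_tendsto_0 lim lim' lim'')
  then have "(?F \<longlongrightarrow> 0) at_top" by simp
  from nn_integral_FTC_atLeast_0[OF f F' _ this, of 0]
  show "(\<integral>\<^sup>+ u. ennreal (l * exp (- l * u) * elastic_tail l t u) * indicator {0..} u \<partial>lborel)
    = ennreal (l * (2 * t * gauss_density t 0 - l * t * elastic_tail l t 0))"
    "l * (2 * t * gauss_density t 0 - l * t * elastic_tail l t 0) \<ge> 0"
    using assms elastic_tail_nonneg by (simp_all add: algebra_simps)
qed

lemma elastic_tail_0: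
  assumes "t > 0"
  shows "elastic_tail a t 0 = mittag_leffler (1/2) 1 (- (a * sqrt t / sqrt 2))"
proof -
  have "a * t / sqrt (2 * t) = a * sqrt t / sqrt 2"
    using assms by (simp add: real_sqrt_mult field_simps)
  then show ?thesis by (simp add: elastic_tail_def erfcx_def)
qed

theorem theorem2p3:
  fixes M :: "'a measure" and B :: "real \<Rightarrow> 'a \<Rightarrow> real" and U :: "'a \<Rightarrow> real"
    and \<alpha> lam :: real and \<psi> :: "real \<Rightarrow> real"
  assumes M: "prob_space M"
    and "lam > 0" and "\<alpha> > 0"
    and U: "distributed M lborel U (exponential_density lam)"
    and B: "\<And>t. t > 0 \<Longrightarrow> has_elastic_law M \<alpha> t (B t)"
    and indep: "\<And>t. t > 0 \<Longrightarrow> prob_space.indep_var M borel (B t) borel U"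
    and \<psi>: "\<psi> = crossing_prob M B U"
  shows "(lam \<noteq> \<alpha> \<longrightarrow> (\<forall>t>0. \<psi> t = 1 - lam / (lam - \<alpha>) *
            (mittag_leffler (1/2) 1 (- (\<alpha> * sqrt t / sqrt 2))
             - mittag_leffler (1/2) 1 (- (lam * sqrt t / sqrt 2)))))
       \<and> (\<alpha> = lam \<longrightarrow> (\<forall>t>0. \<psi> t = 1 - lam * sqrt (2 * t) *
            mittag_leffler (1/2) (1/2) (- (lam * sqrt t / sqrt 2))))
       \<and> (\<forall>t>0. \<psi> differentiable (at t)
            \<and> set_integrable lborel {0<..<t} (caputo_half_integrand \<psi> t)
            \<and> deriv \<psi> t + (\<alpha> + lam) / sqrt 2 * caputo_half \<psi> t
                = \<alpha> * lam / 2 * (1 - \<psi> t) - lam / sqrt (2 * pi * t))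
       \<and> (\<psi> \<longlongrightarrow> 1) (at_right 0)"
proof -
  interpret prob_space M by (rule M)
  note lam = \<open>lam > 0\<close> and \<alpha> = \<open>\<alpha> > 0\<close>
  have tail: "emeasure (distr M borel (B t)) {u..} = ennreal (elastic_tail \<alpha> t u)" if "t > 0" "u > 0" for t u
    using emeasure_elastic_law_atLeast[OF B[OF that(1)] that(1) \<alpha> that(2)] .
  have \<psi>_eq: "\<psi> t = 1 - c"
    if "t > 0" "(\<integral>\<^sup>+ u. ennreal (lam * exp (- lam * u) * elastic_tail \<alpha> t u) * indicator {0..} u \<partial>lborel) = ennreal c" "c \<ge> 0"
    for t c
    unfolding \<psi> crossing_prob_def
    by (rule prob_less_exponential[OF U lam indep[OF that(1)] tail[OF that(1)] that(2,3)])
  have neq: "\<psi> t = 1 - lam / (lam - \<alpha>) * (mittag_leffler (1/2) 1 (- (\<alpha> * sqrt t / sqrt 2))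
      - mittag_leffler (1/2) 1 (- (lam * sqrt t / sqrt 2)))" if "lam \<noteq> \<alpha>" "t > 0" for t
    using \<psi>_eq[OF that(2) nn_integral_elastic_tail_neq[OF that(2) \<alpha> lam that(1)]] that
    by (simp add: elastic_tail_0)
  have eq: "\<psi> t = 1 - lam * sqrt (2 * t) * mittag_leffler (1/2) (1/2) (- (lam * sqrt t / sqrt 2))"
    if "\<alpha> = lam" "t > 0" for t
  proof -
    let ?z = "- (lam * sqrt t / sqrt 2)"
    have "2 * t * gauss_density t 0 = sqrt (2 * t) / sqrt pi"
      using that(2) by (simp add: gauss_density_def real_sqrt_mult field_simps)
    moreover have "lam * t = sqrt (2 * t) * (lam * sqrt t / sqrt 2)"
      using that(2) by (simp add: real_sqrt_mult)
    ultimately have "2 * t * gauss_density t 0 - lam * t * elastic_tail lam t 0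
        = sqrt (2 * t) * mittag_leffler (1/2) (1/2) ?z"
      unfolding elastic_tail_0[OF that(2)] mittag_leffler_half_half by (simp add: algebra_simps)
    then show ?thesis
      using \<psi>_eq[OF that(2), unfolded that(1), OF nn_integral_elastic_tail_eq[OF that(2) lam]] by simp
  qed
  \<comment> \<open>-a and -l are the roots of x^2 + (a + l) x + a l. The sqrt 2 stems from the
    variance t, which makes the argument of \<open>erfcx\<close> at u = 0 equal to a sqrt t.\<close>
  define a l where "a = \<alpha> / sqrt 2" and "l = lam / sqrt 2"
  \<comment> \<open>Both cases reduce to the same data: \<open>b 0 = 0\<close> yields the initial
    value 1 and \<open>b 1 = - l\<close> the singular source term.\<close>
  have "\<exists>b. geometric_growth b \<and> b 0 = 0 \<and> b 1 = - l \<and>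
      (\<forall>r. b (Suc (Suc r)) + (a + l) * b (Suc r) + a * l * b r = 0) \<and>
      (\<forall>t>0. \<psi> t = 1 + ml_series b (sqrt t))"
  proof (cases "lam = \<alpha>")
    case True
    \<comment> \<open>Double root -l: a solution vanishing at r = 0 is a multiple of r (-l)^r, and
      \<open>b 1 = - l\<close> makes the multiple 1.\<close>
    define b where "b r = real r * (- l) ^ r" for r
    have "\<psi> t = 1 + ml_series b (sqrt t)" if "t > 0" for t
    proof -
      have "lam * sqrt (2 * t) = 2 * (l * sqrt t)" using that
        by (simp add: l_def real_sqrt_mult field_simps)
      then have "\<psi> t = 1 - 2 * (l * sqrt t) * mittag_leffler (1/2) (1/2) (- l * sqrt t)"
        using eq[OF True[symmetric] that] by (simp add: l_def)
      then show ?thesis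
        using mittag_leffler_half_half_ml_series[of "- l" "sqrt t"] by (simp add: b_def[abs_def])
    qed
    moreover have "a = l" using True by (simp add: a_def l_def)
    then have "b (Suc (Suc r)) + (a + l) * b (Suc r) + a * l * b r = 0" for r
      by (simp add: b_def algebra_simps)
    moreover have "geometric_growth b"
      unfolding b_def by (rule geometric_growth_mult_power)
    ultimately show ?thesis by (intro exI[of _ b]) (auto simp: b_def)
  next
    case False
    define k where "k = lam / (lam - \<alpha>)"
    \<comment> \<open>Distinct roots: the opposite weights give \<open>b 0 = 0\<close>, and
      \<open>k\<close> gives \<open>b 1 = - l\<close> because a - l is -(\<open>lam\<close> -
      \<open>\<alpha>\<close>) / sqrt 2.\<close>
    define b where "b r = (- k) * (- a) ^ r + k * (- l) ^ r" for r
    have "geometric_growth b"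
      unfolding b_def by (intro geometric_growth_add geometric_growth_cmult geometric_growth_power)
    moreover have "\<psi> t = 1 + ml_series b (sqrt t)" if "t > 0" for t
    proof -
      have "ml_series b (sqrt t) = (- k) * mittag_leffler (1/2) 1 (- a * sqrt t) + k * mittag_leffler (1/2) 1 (- l * sqrt t)"
        unfolding b_def mittag_leffler_half_one
        by (simp only: ml_series_add ml_series_cmult geometric_growth_cmult geometric_growth_power)
      then show ?thesis using neq[OF False that, folded k_def] by (simp add: a_def l_def right_diff_distrib)
    qed
    moreover have "b (Suc (Suc r)) + (a + l) * b (Suc r) + a * l * b r = 0" for r
      by (simp add: b_def algebra_simps)
    moreover have "b 1 = - l"
    proof -
      have "b 1 = k * (a - l)" by (simp add: b_def algebra_simps)
      also have "a - l = - (lam - \<alpha>) / sqrt 2" by (simp add: a_def l_def diff_divide_distrib)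
      also have "k * \<dots> = - (k * (lam - \<alpha>)) / sqrt 2" by (simp add: algebra_simps diff_divide_distrib)
      also have "k * (lam - \<alpha>) = lam" using False by (simp add: k_def)
      finally show ?thesis by (simp add: l_def)
    qed
    ultimately show ?thesis by (intro exI[of _ b]) (auto simp: b_def)
  qed
  then obtain b where b: "geometric_growth b" "b 0 = 0" "b 1 = - l"
    and rec: "\<And>r. b (Suc (Suc r)) + (a + l) * b (Suc r) + a * l * b r = 0"
    and \<psi>_b: "\<And>t. t > 0 \<Longrightarrow> \<psi> t = 1 + ml_series b (sqrt t)"
    by blast
  have ode: "\<psi> differentiable (at t)
      \<and> set_integrable lborel {0<..<t} (caputo_half_integrand \<psi> t)
      \<and> deriv \<psi> t + (\<alpha> + lam) / sqrt 2 * caputo_half \<psi> t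
          = \<alpha> * lam / 2 * (1 - \<psi> t) - lam / sqrt (2 * pi * t)" if "t > 0" for t
  proof -
    note * = ml_series_fractional_ode[OF b(1) \<psi>_b rec that]
    have "a + l = (\<alpha> + lam) / sqrt 2" "a * l = \<alpha> * lam / 2" "l / sqrt (pi * t) = lam / sqrt (2 * pi * t)"
      by (simp_all add: a_def l_def add_divide_distrib real_sqrt_mult)
    with *[unfolded b(3)] show ?thesis by simp
  qed
  \<comment> \<open>The series formula holds for t > 0, so the initial value is a right limit, taken
    by continuity of the series at sqrt 0.\<close>
  have "(\<psi> \<longlongrightarrow> 1) (at_right 0)"
  proof (rule Lim_transform_eventually)
    have "((\<lambda>t. 1 + ml_series b (sqrt t)) \<longlongrightarrow> 1 + ml_series b (sqrt 0)) (at_right 0)"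
      by (intro tendsto_intros isCont_tendsto_compose[OF isCont_ml_series[OF b(1)]])
    then show "((\<lambda>t. 1 + ml_series b (sqrt t)) \<longlongrightarrow> 1) (at_right 0)"
      by (simp add: ml_series_0 b(2))
    show "eventually (\<lambda>t. 1 + ml_series b (sqrt t) = \<psi> t) (at_right 0)"
      using eventually_at_right_less[of 0] by eventually_elim (simp add: \<psi>_b)
  qed
  with neq eq ode show ?thesis by blast
qed

end
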